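(* Let $G$ be an $n$-vertex graph with lambda chromatic number $t\ge5$ and $n\ge t+1$. If $G$ contains maximum number of edges, then $G$ admits an optimal equitable partition, i.e. there is an optimal lambda colouring of $G$ whose coloured partition $C_0,\ldots,C_t$ is equitable.
   Context: All graphs are simple, with finite non-empty vertex set. $d_G(u,v)$ denotes distance in $G$ ($\infty$ if no path joins $u$ and $v$). A lambda colouring of $G$ is a map $c:V(G)\to\mathbb{N}=\{0,1,2,\ldots\}$ with $|c(u)-c(v)|+d_G(u,v)\ge 3$ for all distinct vertices $u,v$, normalised so that $\min_u c(u)=0$. The lambda chromatic number of $G$ is the minimum of $\max_u c(u)$ over all lambda colourings $c$; $c$ is optimal if $\max_u c(u)$ equals the lambda chromatic number. The coloured partition with respect to $c$ is $C_0,\ldots,C_T$, where $T=\max_u c(u)$ and $C_m=\{u: c(u)=m\}$. It is equitable if $\big||C_i|-|C_j|\big|\le1$ for all $0\le i,j\le T$. An $n$-vertex graph with lambda chromatic number $t$ "contains maximum number of edges" if no $n$-vertex graph with lambda chromatic number $t$ has more edges. *)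

theory Defs
  imports "Graph_Theory.Graph_Theory"
begin

text \<open>
  Following the Graph_Theory library, an undirected simple graph is a finite symmetric loop-free
  digraph without parallel arcs: every edge \<open>{u, v}\<close> is represented by both arcs
  \<open>(u, v)\<close> and \<open>(v, u)\<close>.
\<close>

definition simple_graph :: "'a pair_pre_digraph \<Rightarrow> bool" where
  "simple_graph G \<longleftrightarrow> pair_graph G \<and> pverts G \<noteq> {}"

definition edges :: "'a pair_pre_digraph \<Rightarrow> 'a set set" where
  "edges G = {{u, v} | u v. (u, v) \<in> parcs G}"

text \<open>
  The library's shortest-path distance with all arcs of weight 1; it is \<open>\<infinity>\<close> if there is no walk.
\<close>

definition graph_dist :: "'a pair_pre_digraph \<Rightarrow> 'a \<Rightarrow> 'a \<Rightarrow> ereal" where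
  "graph_dist G u v = wf_digraph.\<mu> (with_proj G) (\<lambda>_. 1) u v"

text \<open>
  Colourings are total functions, but only their values on \<open>pverts G\<close> matter.
\<close>

definition lambda_colouring :: "'a pair_pre_digraph \<Rightarrow> ('a \<Rightarrow> nat) \<Rightarrow> bool" where
  "lambda_colouring G c \<longleftrightarrow>
     (\<forall>u \<in> pverts G. \<forall>v \<in> pverts G. u \<noteq> v \<longrightarrow>
        ereal \<bar>real (c u) - real (c v)\<bar> + graph_dist G u v \<ge> 3) \<and>
     Min (c ` pverts G) = 0"

definition max_colour :: "'a pair_pre_digraph \<Rightarrow> ('a \<Rightarrow> nat) \<Rightarrow> nat" where
  "max_colour G c = Max (c ` pverts G)"

definition lambda_chromatic_number :: "'a pair_pre_digraph \<Rightarrow> nat" where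
  "lambda_chromatic_number G = (LEAST k. \<exists>c. lambda_colouring G c \<and> max_colour G c = k)"

definition optimal_colouring :: "'a pair_pre_digraph \<Rightarrow> ('a \<Rightarrow> nat) \<Rightarrow> bool" where
  "optimal_colouring G c \<longleftrightarrow>
     lambda_colouring G c \<and> max_colour G c = lambda_chromatic_number G"

definition colour_class :: "'a pair_pre_digraph \<Rightarrow> ('a \<Rightarrow> nat) \<Rightarrow> nat \<Rightarrow> 'a set" where
  "colour_class G c m = {u \<in> pverts G. c u = m}"

definition equitable_partition :: "'a pair_pre_digraph \<Rightarrow> ('a \<Rightarrow> nat) \<Rightarrow> bool" where
  "equitable_partition G c \<longleftrightarrow>
     (\<forall>i \<le> max_colour G c. \<forall>j \<le> max_colour G c.
        \<bar>int (card (colour_class G c i)) - int (card (colour_class G c j))\<bar> \<le> 1)"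

text \<open>
  The competitors \<open>H\<close> live on the same vertex type as \<open>G\<close>. This is no restriction: every graph with
  as many vertices as \<open>G\<close> is isomorphic to one with vertex set \<open>pverts G\<close>.
\<close>

definition contains_max_edges :: "'a pair_pre_digraph \<Rightarrow> bool" where
  "contains_max_edges G \<longleftrightarrow>
     (\<forall>H :: 'a pair_pre_digraph.
        simple_graph H \<longrightarrow> card (pverts H) = card (pverts G) \<longrightarrow>
        lambda_chromatic_number H = lambda_chromatic_number G \<longrightarrow>
        card (edges H) \<le> card (edges G))"

end

theory Submission
  imports Defs
begin

text \<open>
  In fact \<^emph>\<open>every\<close> optimal colouring of an edge-maximal graph is equitable.

  Let a graph on \<open>n\<close> vertices be coloured with the colours \<open>0, \<dots>, t\<close>, and let \<open>s i\<close> be the size of the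
  \<open>i\<close>-th colour class. Two vertices of one class are at distance at least 3, so they have no common
  neighbour; hence the edges between two classes \<open>i\<close> and \<open>j\<close> form a matching, and there are none if
  \<open>\<bar>i - j\<bar> \<le> 1\<close>. The number of edges is therefore at most the sum of \<open>min (s i) (s j)\<close> over
  the pairs with \<open>i + 2 \<le> j\<close> (\<open>card_edges_le\<close>). Slice this bound horizontally: with the levels
  \<open>L k = {i. k < s i}\<close> it becomes the sum over \<open>k\<close> of the number of separated pairs in \<open>L k\<close>, while
  the sizes of the levels add up to \<open>n\<close>.

  A set of \<open>m\<close> colours has at most \<open>max_separated t m\<close> separated pairs: all pairs, minus the
  consecutive ones that cannot be avoided once \<open>m\<close> exceeds half of the colours. So the question is how
  to split \<open>n\<close> into level sizes of at most \<open>t + 1\<close> such that the sum of \<open>max_separated t\<close> is largest.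
  Although this function is not convex, two levels that are both nonempty and not full always lose
  against merging them, that is, against filling one of them as far as possible from the other
  (\<open>layered_max_strict\<close>). Hence the largest value is \<open>layered_max t n\<close>, obtained from full levels and
  one remainder. If \<open>s b + 2 \<le> s a\<close> for two classes, then the levels \<open>s b\<close> and
  \<open>s b + 1\<close> contain \<open>a\<close> but not \<open>b\<close>, so there are two such bad levels and the number of edges is below
  \<open>layered_max t n\<close> (\<open>nearly_equal_if_extremal\<close>).

  Finally \<open>layered_max t n\<close> is attained by a graph with the same lambda chromatic number
  (\<open>ex_layered_graph\<close>): a disjoint union with one part for each level, namely the subgraph that a best
  set of colours induces in the complement of the path on \<open>0, \<dots>, t\<close>. Its first
  level has all \<open>t + 1\<close> colours and, as \<open>t \<ge> 5\<close>, diameter 2; this forces \<open>t + 1\<close> different colours.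
\<close>

section \<open>Separated pairs of colours\<close>

definition separated_pairs :: "nat set \<Rightarrow> (nat \<times> nat) set" where
  "separated_pairs S = {(i, j) \<in> S \<times> S. i + 2 \<le> j}"

definition consecutive :: "nat set \<Rightarrow> nat set" where
  "consecutive S = {i \<in> S. Suc i \<in> S}"

text \<open>
  The number of new separated pairs when a best set of \<open>i\<close> colours grows to a best set of \<open>i + 1\<close>
  colours. The new colour is consecutive to no old one as long as the colours of the parity of \<open>t\<close>
  last (\<open>2 * i \<le> t\<close>). When they are used up and \<open>t\<close> is odd (\<open>2 * i = t + 1\<close>), the end point \<open>0\<close> is
  free and is consecutive to \<open>1\<close> only. Every other new colour is consecutive to two old ones.
\<close>

definition gain :: "nat \<Rightarrow> nat \<Rightarrow> nat" where
  "gain t i = i - min 2 (2 * i - t)"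

text \<open>
  For \<open>m \<le> t + 1\<close>, the number of edges of a densest \<open>m\<close>-vertex subgraph of the complement of the
  path on \<open>0, \<dots>, t\<close>.
\<close>

definition max_separated :: "nat \<Rightarrow> nat \<Rightarrow> nat" where
  "max_separated t m = (\<Sum>i<m. gain t i)"

definition layered_max :: "nat \<Rightarrow> nat \<Rightarrow> nat" where
  "layered_max t n = n div (t + 1) * max_separated t (t + 1) + max_separated t (n mod (t + 1))"

lemma finite_separated_pairs [simp]: "finite S \<Longrightarrow> finite (separated_pairs S)"
  unfolding separated_pairs_def by (rule finite_subset[of _ "S \<times> S"]) auto

lemma finite_consecutive [simp]: "finite S \<Longrightarrow> finite (consecutive S)"
  unfolding consecutive_def by simp

text \<open>Every pair of distinct elements is either separated or consecutive.\<close>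

lemma card_separated_pairs:
  assumes "finite S"
  shows "card (separated_pairs S) + card (consecutive S) = (\<Sum>i<card S. i)"
  using assms
proof (induction S rule: finite_linorder_max_induct)
  case empty
  then show ?case by (simp add: separated_pairs_def consecutive_def)
next
  case (insert b A)
  have b: "b \<notin> A" using insert by auto
  let ?P = "{i \<in> A. i + 2 \<le> b}" and ?Q = "{i \<in> A. Suc i = b}"
  have "separated_pairs (insert b A) = separated_pairs A \<union> (\<lambda>i. (i, b)) ` ?P"
    using insert.hyps by (fastforce simp: separated_pairs_def)
  moreover have "separated_pairs A \<inter> (\<lambda>i. (i, b)) ` ?P = {}"
    using b by (auto simp: separated_pairs_def)
  ultimately have 1: "card (separated_pairs (insert b A)) = card (separated_pairs A) + card ?P"
    using insert.hyps by (simp add: card_Un_disjoint card_image inj_on_def)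
  have "consecutive (insert b A) = consecutive A \<union> ?Q"
    using insert.hyps by (fastforce simp: consecutive_def)
  moreover have "consecutive A \<inter> ?Q = {}"
    using b by (auto simp: consecutive_def)
  ultimately have 2: "card (consecutive (insert b A)) = card (consecutive A) + card ?Q"
    using insert.hyps by (simp add: card_Un_disjoint)
  have "?P \<union> ?Q = A"
    using insert.hyps by fastforce
  moreover have "card (?P \<union> ?Q) = card ?P + card ?Q"
    using insert.hyps by (intro card_Un_disjoint) auto
  ultimately have "card ?P + card ?Q = card A" by simp
  then show ?case using 1 2 b insert by simp
qed

text \<open>
  Consecutive elements are the overlap of \<open>S\<close> with its shift. If \<open>S\<close> is a set of
  colours up to \<open>t\<close>, then both lie in \<open>{0..t + 1}\<close>; this bounds the number of consecutive pairs from below, and it shows when the bound is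
  sharp: when the overlap is empty, or the union is everything.
\<close>

lemma card_Un_Suc_image:
  assumes "finite S"
  shows "card (S \<union> Suc ` S) + card (consecutive S) = 2 * card S"
proof -
  have "Suc ` consecutive S = S \<inter> Suc ` S"
    by (auto simp: consecutive_def)
  then have "card (S \<inter> Suc ` S) = card (consecutive S)"
    by (metis card_image inj_Suc inj_on_subset subset_UNIV)
  then show ?thesis
    using card_Un_Int[of S "Suc ` S"] assms by (simp add: card_image)
qed

lemma max_separated_eq:
  assumes "1 \<le> t"
  shows "max_separated t m + (2 * m - (t + 2)) = (\<Sum>i<m. i)"
proof (induction m)
  case 0
  then show ?case by (simp add: max_separated_def)
next
  case (Suc m)
  have "gain t m + min 2 (2 * m - t) = m"
    using assms by (auto simp: gain_def)
  with Suc show ?case by (auto simp: max_separated_def)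
qed

lemma card_separated_pairs_le:
  assumes "1 \<le> t" "S \<subseteq> {..t}"
  shows "card (separated_pairs S) \<le> max_separated t (card S)"
proof -
  have fin: "finite S" using assms(2) finite_subset by blast
  have "S \<union> Suc ` S \<subseteq> {..Suc t}" using assms(2) by auto
  then have "card (S \<union> Suc ` S) \<le> t + 2"
    using card_mono[of "{..Suc t}"] by fastforce
  then show ?thesis
    using card_Un_Suc_image[OF fin] card_separated_pairs[OF fin] max_separated_eq[OF assms(1), of "card S"]
    by linarith
qed

lemma card_same_parity: "card {i. i \<le> t \<and> even (i + t)} = t div 2 + 1"
proof -
  have "{i. i \<le> t \<and> even (i + t)} = (\<lambda>k. t - 2 * k) ` {..t div 2}"
  proof (intro set_eqI iffI)
    fix i assume "i \<in> {i. i \<le> t \<and> even (i + t)}"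
    then have "i \<le> t" "even (t - i)" by auto
    then have "i = t - 2 * ((t - i) div 2)" "(t - i) div 2 \<in> {..t div 2}"
      by (auto simp: div_le_mono)
    then show "i \<in> (\<lambda>k. t - 2 * k) ` {..t div 2}" by blast
  qed auto
  moreover have "inj_on (\<lambda>k. t - 2 * k) {..t div 2}"
    by (rule inj_onI) auto
  ultimately show ?thesis by (simp add: card_image)
qed

text \<open>
  A best set takes colours of the parity of \<open>t\<close> only, if there are enough of them; otherwise it
  contains all of these and the colour \<open>0\<close>. In the second case the set and its shift cover \<open>{0..t + 1}\<close>,
  where \<open>0\<close> is needed because it is not in any shift.
\<close>

lemma ex_max_separated:
  assumes "1 \<le> t" "r \<le> t + 1"
  obtains S where "S \<subseteq> {..t}" "card S = r" "card (separated_pairs S) = max_separated t r"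
proof -
  let ?P = "{i. i \<le> t \<and> even (i + t)}"
  have "\<exists>S\<subseteq>{..t}. card S = r \<and> card (consecutive S) = 2 * r - (t + 2)"
  proof (cases "r \<le> card ?P")
    case True
    then obtain S where S: "S \<subseteq> ?P" "card S = r"
      using obtain_subset_with_card_n[OF True] by blast
    have "i \<notin> consecutive S" for i
    proof
      assume "i \<in> consecutive S"
      then have "i \<in> ?P" "Suc i \<in> ?P" using S(1) by (auto simp only: consecutive_def)
      then show False by auto
    qed
    then have "consecutive S = {}" by blast
    moreover have "2 * r \<le> t + 2"
      using True card_same_parity[of t] by linarith
    ultimately show ?thesis using S by (intro exI[of _ S]) auto
  next
    case False
    let ?B = "insert 0 ?P"
    have "card (insert 0 A) \<le> Suc (card A)" for A :: "nat set"
      by (cases "finite A") (simp_all add: card_insert_if)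
    then have "card ?B \<le> r"
      using False by (meson le_trans not_less_eq_eq)
    moreover have "?B \<subseteq> {..t}" by auto
    moreover have "r \<le> card {..t}" using assms by simp
    ultimately obtain S where S: "?B \<subseteq> S" "S \<subseteq> {..t}" "card S = r"
      using exists_subset_between[of ?B r "{..t}"] by auto
    have "S \<union> Suc ` S = {..Suc t}"
    proof
      show "S \<union> Suc ` S \<subseteq> {..Suc t}" using S(2) by auto
      show "{..Suc t} \<subseteq> S \<union> Suc ` S"
      proof
        fix j assume j: "j \<in> {..Suc t}"
        show "j \<in> S \<union> Suc ` S"
        proof (cases "j = 0 \<or> even (j + t)")
          case True
          then have "j \<in> ?B" using j by (auto simp: le_Suc_eq)
          then show ?thesis using S(1) by blast
        next
          case False
          then obtain i where "j = Suc i" by (cases j) auto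
          with False j have "i \<in> ?P" by auto
          then show ?thesis using S(1) \<open>j = Suc i\<close> by auto
        qed
      qed
    qed
    moreover have "finite S" using S(2) finite_subset by blast
    ultimately have "t + 2 + card (consecutive S) = 2 * r"
      using card_Un_Suc_image[of S] S(3) by simp
    then show ?thesis using S by (intro exI[of _ S]) auto
  qed
  then obtain S where S: "S \<subseteq> {..t}" "card S = r" "card (consecutive S) = 2 * r - (t + 2)"
    by blast
  moreover have "finite S" using S(1) finite_subset by blast
  ultimately have "card (separated_pairs S) = max_separated t r"
    using card_separated_pairs[of S] max_separated_eq[OF assms(1), of r] by simp
  with S that show ?thesis by blast
qed

section \<open>Strict superadditivity\<close>

lemma max_separated_0 [simp]: "max_separated t 0 = 0"
  by (simp add: max_separated_def)

lemma max_separated_Suc [simp]: "max_separated t (Suc m) = max_separated t m + gain t m"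
  by (simp add: max_separated_def)

text \<open>
  The increment \<open>gain t\<close> falls behind the identity by at most 2, so it does not decrease when its
  argument grows by at least 2. For \<open>a \<ge> 2\<close> the increments collected on the way from \<open>a\<close> to
  \<open>a + b\<close> therefore dominate those from \<open>0\<close> to \<open>b\<close>,
  and the first one is strictly larger because \<open>gain t 0 = 0\<close>.
\<close>

lemma max_separated_superadditive:
  assumes t: "3 \<le> t" and "1 \<le> a" "1 \<le> b"
  shows "max_separated t a + max_separated t b < max_separated t (a + b)"
proof -
  have main: "max_separated t a + max_separated t b < max_separated t (a + b)"
    if "2 \<le> a" "1 \<le> b" for a b
    using that(2)
  proof (induction b rule: dec_induct)
    case base
    have "0 < gain t a" using that(1) t by (auto simp: gain_def min_def)
    then show ?case by (simp add: gain_def)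
  next
    case (step b)
    have "gain t b \<le> gain t (a + b)" using that(1) by (auto simp: gain_def)
    with step show ?case by simp
  qed
  consider "2 \<le> a" | "2 \<le> b" | "a = 1" "b = 1" using assms by linarith
  then show ?thesis
  proof cases
    case 1
    then show ?thesis using main assms by blast
  next
    case 2
    then show ?thesis using main[of b a] assms by (simp add: add.commute)
  next
    case 3
    then show ?thesis using t by (simp add: gain_def numeral_2_eq_2)
  qed
qed

text \<open>A shift by at least 3 makes every increment strictly larger.\<close>

lemma max_separated_shift:
  assumes "c + 3 \<le> a" "1 \<le> g" "2 \<le> t"
  shows "max_separated t a + max_separated t (c + g) < max_separated t (a + g) + max_separated t c"
  using assms(2)
proof (induction g rule: dec_induct)
  case base
  have "gain t c < gain t a" using assms by (auto simp: gain_def)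
  then show ?case by simp
next
  case (step g)
  have "gain t (c + g) \<le> gain t (a + g)" using assms by (auto simp: gain_def)
  with step show ?case by simp
qed

text \<open>
  Filling the level of size \<open>a\<close> moves \<open>t + 1 - a\<close> colours from the level of size \<open>b\<close>; the increments
  that are won lie \<open>t + 1 - b\<close> above the increments that are lost. So \<open>max_separated_shift\<close> settles the case
  \<open>b + 2 \<le> t\<close>, and the case \<open>a + 2 \<le> t\<close> by symmetry. The remaining sizes \<open>t - 1\<close> and \<open>t\<close> are compared
  increment by increment.
\<close>

lemma max_separated_overflow:
  assumes t: "5 \<le> t" and a: "1 \<le> a" "a \<le> t" and b: "1 \<le> b" "b \<le> t" and ab: "t + 1 \<le> a + b"
  shows "max_separated t a + max_separated t b
    < max_separated t (t + 1) + max_separated t (a + b - (t + 1))"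
proof -
  have main: "max_separated t a + max_separated t b
      < max_separated t (t + 1) + max_separated t (a + b - (t + 1))"
    if "a \<le> t" "b + 2 \<le> t" "t + 1 \<le> a + b" for a b
    using max_separated_shift[of "a + b - (t + 1)" a "t + 1 - a" t] that t by simp
  consider "b + 2 \<le> t" | "a + 2 \<le> t" | "a \<in> {t - 1, t}" "b \<in> {t - 1, t}"
    using a b by fastforce
  then show ?thesis
  proof cases
    case 1
    then show ?thesis using main[of a b] a ab by blast
  next
    case 2
    then show ?thesis using main[of b a] b ab by (simp add: add.commute)
  next
    case 3
    \<comment> \<open>All sizes involved lie between \<open>t - 3\<close> and \<open>t + 1\<close>.\<close>
    define w where "w = t - 3"
    have w: "t = Suc (Suc (Suc w))" "2 \<le> w" using t by (simp_all add: w_def)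
    have "gain t w \<le> w" "gain t (Suc w) \<le> w"
      "gain t (Suc (Suc w)) = w" "gain t (Suc (Suc (Suc w))) = Suc w"
      using w by (auto simp: gain_def)
    moreover have "max_separated t (t + 1) = max_separated t w + gain t w + gain t (Suc w)
        + gain t (Suc (Suc w)) + gain t (Suc (Suc (Suc w)))"
      "max_separated t t = max_separated t w + gain t w + gain t (Suc w) + gain t (Suc (Suc w))"
      "max_separated t (t - 1) = max_separated t w + gain t w + gain t (Suc w)"
      "max_separated t (t - 2) = max_separated t w + gain t w"
      "max_separated t (t - 3) = max_separated t w"
      using w(1) by simp_all
    moreover have "(a = t \<and> b = t \<and> a + b - (t + 1) = t - 1) \<or>
        (a = t - 1 \<and> b = t \<and> a + b - (t + 1) = t - 2) \<or>
        (a = t \<and> b = t - 1 \<and> a + b - (t + 1) = t - 2) \<or>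
        (a = t - 1 \<and> b = t - 1 \<and> a + b - (t + 1) = t - 3)"
      using 3 t by auto
    ultimately show ?thesis by (elim disjE conjE) simp_all
  qed
qed

lemma layered_max_mult_add:
  "layered_max t (q * (t + 1) + x) = q * max_separated t (t + 1) + layered_max t x"
proof -
  have "(q * (t + 1) + x) div (t + 1) = q + x div (t + 1)" "(q * (t + 1) + x) mod (t + 1) = x mod (t + 1)"
    by (rule div_mult_self3, simp) (rule mod_mult_self3)
  then show ?thesis
    unfolding layered_max_def by (simp add: add_mult_distrib del: max_separated_Suc)
qed

lemma layered_max_le: "m \<le> t + 1 \<Longrightarrow> layered_max t m = max_separated t m"
  by (cases "m = t + 1") (simp_all add: layered_max_def del: max_separated_Suc)

text \<open>Two levels that are neither empty nor full can be rearranged with a gain.\<close>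

lemma layered_max_strict:
  assumes t: "5 \<le> t" and a: "1 \<le> a" "a \<le> t" and b: "1 \<le> b" "b \<le> t"
  shows "max_separated t a + max_separated t b < layered_max t (a + b)"
proof (cases "a + b \<le> t + 1")
  case True
  then show ?thesis using max_separated_superadditive[of t a b] assms
    by (simp only: layered_max_le)
next
  case False
  then have "layered_max t (a + b) = max_separated t (t + 1) + max_separated t (a + b - (t + 1))"
    using layered_max_mult_add[of t 1 "a + b - (t + 1)"] a b
    by (simp add: layered_max_le del: max_separated_Suc)
  then show ?thesis using max_separated_overflow[of t a b] assms False by simp
qed

lemma layered_max_superadditive:
  assumes t: "5 \<le> t"
  shows "layered_max t x + layered_max t y \<le> layered_max t (x + y)"
proof -
  define p r where "p = x div (t + 1)" and "r = x mod (t + 1)"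
  define q s where "q = y div (t + 1)" and "s = y mod (t + 1)"
  have x: "x = p * (t + 1) + r" and r: "r \<le> t"
    unfolding p_def r_def using mod_less_divisor[of "t + 1" x] by (simp_all only: div_mult_mod_eq) linarith
  have y: "y = q * (t + 1) + s" and s: "s \<le> t"
    unfolding q_def s_def using mod_less_divisor[of "t + 1" y] by (simp_all only: div_mult_mod_eq) linarith
  have "max_separated t r + max_separated t s \<le> layered_max t (r + s)"
  proof (cases "r = 0 \<or> s = 0")
    case True
    then show ?thesis using r s by (auto simp: layered_max_le)
  next
    case False
    then show ?thesis using layered_max_strict[of t r s] t r s by simp
  qed
  moreover have "x + y = (p + q) * (t + 1) + (r + s)"
    using x y by (simp add: algebra_simps)
  ultimately show ?thesis
    using r s unfolding x y
    by (simp only: layered_max_mult_add layered_max_le) (simp add: algebra_simps layered_max_mult_add layered_max_le)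
qed

lemma sum_max_separated_le:
  assumes "5 \<le> t" "finite A" "\<And>k. k \<in> A \<Longrightarrow> m k \<le> t + 1"
  shows "(\<Sum>k\<in>A. max_separated t (m k)) \<le> layered_max t (\<Sum>k\<in>A. m k)"
  using assms(2,3)
proof (induction A rule: finite_induct)
  case empty
  then show ?case by simp
next
  case (insert k A)
  have "max_separated t (m k) = layered_max t (m k)"
    using insert.prems by (simp add: layered_max_le)
  then show ?case
    using insert layered_max_superadditive[OF assms(1), of "m k" "\<Sum>k\<in>A. m k"] by force
qed

section \<open>Slicing a colouring into levels\<close>

text \<open>The layer-cake formula: count the cells below the graph of \<open>g\<close> by rows instead of columns.\<close>

lemma sum_eq_sum_card_levels:
  fixes g :: "'b \<Rightarrow> nat"
  assumes "finite A" "\<And>a. a \<in> A \<Longrightarrow> g a \<le> K"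
  shows "sum g A = (\<Sum>k<K. card {a \<in> A. k < g a})"
proof -
  have "sum g A = (\<Sum>a\<in>A. card {k. k < K \<and> k < g a})"
  proof (rule sum.cong)
    fix a assume "a \<in> A"
    then have "{k. k < K \<and> k < g a} = {..<g a}" using assms(2) by fastforce
    then show "g a = card {k. k < K \<and> k < g a}" by simp
  qed simp
  also have "\<dots> = (\<Sum>a\<in>A. \<Sum>k<K. if k < g a then 1 else 0)"
    by (simp add: sum.If_cases lessThan_def Collect_conj_eq)
  also have "\<dots> = (\<Sum>k<K. \<Sum>a\<in>A. if k < g a then 1 else 0)"
    by (rule sum.swap)
  also have "\<dots> = (\<Sum>k<K. card {a \<in> A. k < g a})"
    using assms(1) by (simp add: sum.If_cases Collect_conj_eq)
  finally show ?thesis .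
qed

text \<open>
  The colours \<open>a\<close> and \<open>b\<close> make the two levels \<open>s b\<close> and \<open>s b + 1\<close> nonempty but not full, if
  \<open>s a \<ge> s b + 2\<close>. The strict inequality for these two, together with the weak inequality for the other
  levels, contradicts extremality.
\<close>

lemma nearly_equal_if_extremal:
  fixes s :: "nat \<Rightarrow> nat"
  assumes t: "5 \<le> t"
    and max: "layered_max t (\<Sum>i\<le>t. s i) \<le> (\<Sum>(i, j)\<in>separated_pairs {..t}. min (s i) (s j))"
    and ab: "a \<le> t" "b \<le> t"
  shows "s a \<le> s b + 1"
proof (rule ccontr)
  assume "\<not> s a \<le> s b + 1"
  then have less: "s b + 2 \<le> s a" by simp
  define K where "K = Max (s ` {..t})"
  have K: "s i \<le> K" if "i \<le> t" for i
    unfolding K_def using that by (intro Max_ge) auto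
  define L where "L k = {i \<in> {..t}. k < s i}" for k
  have sub: "L k \<subseteq> {..t}" for k by (auto simp: L_def)
  have card_L: "card (L k) \<le> t + 1" for k
    using card_mono[OF _ sub[of k]] by simp
  have partial: "1 \<le> card (L k) \<and> card (L k) \<le> t" if "s b \<le> k" "k < s a" for k
  proof -
    have "L k \<subseteq> {..t} - {b}" using that by (auto simp: L_def)
    then have "card (L k) \<le> card ({..t} - {b})" by (intro card_mono) auto
    moreover have "a \<in> L k" using that ab by (simp add: L_def)
    then have "card (L k) > 0" using finite_subset[OF sub] card_gt_0_iff by blast
    ultimately show ?thesis using ab by simp
  qed
  have "(\<Sum>(i, j)\<in>separated_pairs {..t}. min (s i) (s j))
      = (\<Sum>k<K. card {p \<in> separated_pairs {..t}. k < (case p of (i, j) \<Rightarrow> min (s i) (s j))})"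
    using K by (intro sum_eq_sum_card_levels finite_separated_pairs) (auto simp: separated_pairs_def min_le_iff_disj)
  also have "\<dots> = (\<Sum>k<K. card (separated_pairs (L k)))"
    by (intro sum.cong arg_cong[of _ _ card]) (auto simp: separated_pairs_def L_def)
  also have "\<dots> \<le> (\<Sum>k<K. max_separated t (card (L k)))"
    using t sub by (intro sum_mono card_separated_pairs_le) auto
  also have "\<dots> < layered_max t (\<Sum>k<K. card (L k))"
  proof -
    let ?x = "s b" and ?y = "Suc (s b)"
    let ?R = "{..<K} - {?x, ?y}"
    have split: "sum h {..<K} = h ?x + h ?y + sum h ?R" for h :: "nat \<Rightarrow> nat"
    proof -
      have "{?x, ?y} \<subseteq> {..<K}" using less K[OF ab(1)] by auto
      then show ?thesis using sum.subset_diff[of "{?x, ?y}" "{..<K}" h] by simp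
    qed
    have "max_separated t (card (L ?x)) + max_separated t (card (L ?y))
        < layered_max t (card (L ?x) + card (L ?y))"
      using partial[of ?x] partial[of ?y] less t by (intro layered_max_strict) auto
    moreover have "(\<Sum>k\<in>?R. max_separated t (card (L k))) \<le> layered_max t (\<Sum>k\<in>?R. card (L k))"
      using t card_L by (intro sum_max_separated_le) auto
    ultimately show ?thesis
      unfolding split
      using layered_max_superadditive[OF t, of "card (L ?x) + card (L ?y)" "\<Sum>k\<in>?R. card (L k)"]
      by linarith
  qed
  also have "(\<Sum>k<K. card (L k)) = (\<Sum>i\<le>t. s i)"
    unfolding L_def using K by (intro sum_eq_sum_card_levels[symmetric]) auto
  finally show False using max by simp
qed

section \<open>Distances and colourings\<close>

context pair_wf_digraph
begin

lemma awalk_cost_unit: "awalk_cost (\<lambda>_. 1) p = length p"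
  by (induction p) (auto simp: awalk_cost_def)

lemma graph_dist_leI: "awalk u p v \<Longrightarrow> graph_dist G u v \<le> ereal (length p)"
  unfolding graph_dist_def using min_cost_le_walk_cost[of u p v "\<lambda>_. 1"] awalk_cost_unit by simp

lemma graph_dist_geI:
  assumes "\<And>p. awalk u p v \<Longrightarrow> k \<le> length p"
  shows "ereal (real k) \<le> graph_dist G u v"
  unfolding graph_dist_def \<mu>_def
  by (intro INF_greatest) (use assms awalk_cost_unit in auto)

lemma graph_dist_arc_le: "(u, v) \<in> parcs G \<Longrightarrow> graph_dist G u v \<le> 1"
  using graph_dist_leI[of u "[(u, v)]" v] by (auto simp: awalk_simps in_arcsD2 one_ereal_def)

lemma graph_dist_two_arcs_le:
  "(u, w) \<in> parcs G \<Longrightarrow> (w, v) \<in> parcs G \<Longrightarrow> graph_dist G u v \<le> 2"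
  using graph_dist_leI[of u "[(u, w), (w, v)]" v] by (auto simp: awalk_simps in_arcsD2)

lemma graph_dist_distinct_ge: "u \<noteq> v \<Longrightarrow> 1 \<le> graph_dist G u v"
  using graph_dist_geI[of u v 1]
  by (metis Suc_le_eq awalk_Nil_iff length_greater_0_conv of_nat_1 one_ereal_def One_nat_def)

lemma graph_dist_nonadjacent_ge:
  assumes "u \<noteq> v" "(u, v) \<notin> parcs G"
  shows "2 \<le> graph_dist G u v"
proof -
  have "2 \<le> length p" if "awalk u p v" for p
  proof (cases p)
    case Nil
    then show ?thesis using that assms by (simp add: awalk_simps)
  next
    case (Cons e p')
    then show ?thesis using that assms by (cases p') (auto simp: awalk_simps)
  qed
  then show ?thesis using graph_dist_geI[of u v 2] by simp
qed

text \<open>No walk can change the value of a function that is constant along arcs.\<close>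

lemma graph_dist_eq_infinity:
  assumes "\<And>x y. (x, y) \<in> parcs G \<Longrightarrow> g x = g y" "g u \<noteq> g v"
  shows "graph_dist G u v = \<infinity>"
proof -
  have "g x = g v" if "awalk x p v" for x p
    using that
  proof (induction p arbitrary: x)
    case (Cons e p)
    then show ?case using assms(1)[of "fst e" "snd e"] by (auto simp: awalk_simps)
  qed (simp add: awalk_simps)
  then have "{p. awalk u p v} = {}" using assms(2) by auto
  then show ?thesis unfolding graph_dist_def \<mu>_def by (simp add: top_ereal_def)
qed

end

lemma lambda_colouring_neq:
  assumes "lambda_colouring G c" "u \<in> pverts G" "v \<in> pverts G" "u \<noteq> v" "graph_dist G u v \<le> 2"
  shows "c u \<noteq> c v"
proof
  assume "c u = c v"
  then have "3 \<le> graph_dist G u v"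
    using assms(1-4) by (fastforce simp: lambda_colouring_def zero_ereal_def[symmetric])
  then have "(3::ereal) \<le> 2" using assms(5) by (rule order_trans)
  then show False by simp
qed

lemma lambda_colouring_arc:
  assumes "simple_graph G" "lambda_colouring G c" "(u, v) \<in> parcs G"
  shows "c u + 2 \<le> c v \<or> c v + 2 \<le> c u"
proof -
  interpret pair_graph G using assms(1) by (simp add: simple_graph_def)
  have uv: "u \<in> pverts G" "v \<in> pverts G" "u \<noteq> v"
    using assms(3) by (auto simp: in_arcsD1 in_arcsD2 dest: no_loops')
  have "3 \<le> ereal \<bar>real (c u) - real (c v)\<bar> + graph_dist G u v"
    using assms(2) uv by (auto simp: lambda_colouring_def)
  also have "\<dots> \<le> ereal \<bar>real (c u) - real (c v)\<bar> + 1"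
    using graph_dist_arc_le[OF assms(3)] by (rule add_left_mono)
  finally have "3 \<le> \<bar>real (c u) - real (c v)\<bar> + 1"
    by (simp add: one_ereal_def)
  then show ?thesis by linarith
qed

lemma lambda_colouring_neighbours:
  assumes "simple_graph G" "lambda_colouring G c" "(u, v) \<in> parcs G" "(u, w) \<in> parcs G" "c v = c w"
  shows "v = w"
proof (rule ccontr)
  assume "v \<noteq> w"
  interpret pair_graph G using assms(1) by (simp add: simple_graph_def)
  have "graph_dist G v w \<le> 2"
    using graph_dist_two_arcs_le[of v u w] assms(3,4) arcs_symmetric by blast
  then show False
    using lambda_colouring_neq[OF assms(2) _ _ \<open>v \<noteq> w\<close>] assms(3-5) in_arcsD2 by blast
qed

text \<open>
  Colours that are pairwise at least 2 apart always do. This is why the least number in the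
  definition of the lambda chromatic number is attained.
\<close>

lemma ex_lambda_colouring:
  assumes "simple_graph G"
  shows "\<exists>c. lambda_colouring G c"
proof -
  interpret pair_graph G using assms by (simp add: simple_graph_def)
  obtain f where f: "bij_betw f (pverts G) {0..<card (pverts G)}"
    using ex_bij_betw_finite_nat pair_finite_verts by blast
  let ?c = "\<lambda>u. 2 * f u"
  have ne: "pverts G \<noteq> {}" using assms by (simp add: simple_graph_def)
  have "ereal \<bar>real (?c u) - real (?c v)\<bar> + graph_dist G u v \<ge> 3"
    if "u \<in> pverts G" "v \<in> pverts G" "u \<noteq> v" for u v
  proof -
    have "f u \<noteq> f v" using f that by (auto simp: bij_betw_def dest: inj_onD)
    then have "2 \<le> \<bar>real (?c u) - real (?c v)\<bar>" by linarith
    then have "ereal 2 + 1 \<le> ereal \<bar>real (?c u) - real (?c v)\<bar> + graph_dist G u v"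
      using graph_dist_distinct_ge[OF that(3)] by (intro add_mono) simp_all
    then show ?thesis by (simp add: one_ereal_def)
  qed
  moreover have "Min (?c ` pverts G) = 0"
  proof -
    have "0 \<in> f ` pverts G"
      using f ne pair_finite_verts by (auto simp: bij_betw_def card_gt_0_iff)
    then show ?thesis
      using pair_finite_verts by (intro Min_eqI) force+
  qed
  ultimately show ?thesis unfolding lambda_colouring_def by (intro exI[of _ ?c]) blast
qed

lemma ex_optimal_colouring:
  assumes "simple_graph G"
  shows "\<exists>c. optimal_colouring G c"
  using ex_lambda_colouring[OF assms]
    LeastI_ex[of "\<lambda>k. \<exists>c. lambda_colouring G c \<and> max_colour G c = k"]
  unfolding optimal_colouring_def lambda_chromatic_number_def by blast

section \<open>Counting the edges of a coloured graph\<close>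

text \<open>
  Direct each edge from its smaller to its larger colour. The arcs \<open>A (i, j)\<close> from class \<open>i\<close> to class \<open>j\<close>
  form a matching, because two neighbours of a vertex have different colours; so both end points
  determine the arc.
\<close>

lemma card_edges_le:
  assumes G: "simple_graph G" and c: "lambda_colouring G c"
    and t: "\<And>u. u \<in> pverts G \<Longrightarrow> c u \<le> t"
  shows "card (edges G) \<le> (\<Sum>(i, j)\<in>separated_pairs {..t}.
    min (card (colour_class G c i)) (card (colour_class G c j)))"
proof -
  interpret pair_graph G using G by (simp add: simple_graph_def)
  define A where "A p = {(u, v) \<in> parcs G. c u = fst p \<and> c v = snd p}" for p
  have fin_A: "finite (A p)" for p
    by (rule finite_subset[OF _ pair_finite_arcs]) (auto simp: A_def)
  have fin_class: "finite (colour_class G c i)" for i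
    using pair_finite_verts by (simp add: colour_class_def)
  have "edges G \<subseteq> (\<lambda>(u, v). {u, v}) ` (\<Union>p\<in>separated_pairs {..t}. A p)"
  proof
    fix e assume "e \<in> edges G"
    then obtain u v where e: "e = {u, v}" "(u, v) \<in> parcs G" by (auto simp: edges_def)
    have uv: "c u \<le> t" "c v \<le> t" using t e(2) in_arcsD1 in_arcsD2 by blast+
    from lambda_colouring_arc[OF G c e(2)]
    show "e \<in> (\<lambda>(u, v). {u, v}) ` (\<Union>p\<in>separated_pairs {..t}. A p)"
    proof
      assume "c u + 2 \<le> c v"
      then have "(u, v) \<in> A (c u, c v)" "(c u, c v) \<in> separated_pairs {..t}"
        using e uv by (auto simp: A_def separated_pairs_def)
      then have "(u, v) \<in> (\<Union>p\<in>separated_pairs {..t}. A p)" by (rule UN_I[rotated])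
      then show ?thesis using e(1) by (intro rev_image_eqI[of "(u, v)"]) auto
    next
      assume "c v + 2 \<le> c u"
      then have "(v, u) \<in> A (c v, c u)" "(c v, c u) \<in> separated_pairs {..t}"
        using e uv arcs_symmetric by (auto simp: A_def separated_pairs_def)
      then have "(v, u) \<in> (\<Union>p\<in>separated_pairs {..t}. A p)" by (rule UN_I[rotated])
      then show ?thesis using e(1) by (intro rev_image_eqI[of "(v, u)"]) auto
    qed
  qed
  then have "card (edges G) \<le> card (\<Union>p\<in>separated_pairs {..t}. A p)"
    using fin_A by (intro surj_card_le) auto
  also have "\<dots> \<le> (\<Sum>p\<in>separated_pairs {..t}. card (A p))"
    by (intro card_UN_le) simp
  also have "\<dots> \<le> (\<Sum>(i, j)\<in>separated_pairs {..t}.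
      min (card (colour_class G c i)) (card (colour_class G c j)))"
  proof (intro sum_mono)
    fix p assume "p \<in> separated_pairs {..t}"
    obtain i j where p: "p = (i, j)" by fastforce
    have "inj_on fst (A p)"
      using lambda_colouring_neighbours[OF G c] by (auto simp: inj_on_def A_def)
    then have "card (A p) \<le> card (colour_class G c i)"
      by (rule card_inj_on_le) (auto simp: fin_class A_def colour_class_def p in_arcsD1)
    moreover have "inj_on snd (A p)"
    proof (rule inj_onI)
      fix x y assume "x \<in> A p" "y \<in> A p" "snd x = snd y"
      then show "x = y"
        using lambda_colouring_neighbours[OF G c, of "snd x" "fst x" "fst y"] arcs_symmetric
        by (auto simp: A_def)
    qed
    then have "card (A p) \<le> card (colour_class G c j)"
      by (rule card_inj_on_le) (auto simp: fin_class A_def colour_class_def p in_arcsD2)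
    ultimately show "card (A p) \<le> (case p of (i, j) \<Rightarrow>
        min (card (colour_class G c i)) (card (colour_class G c j)))"
      by (simp add: p)
  qed
  finally show ?thesis .
qed

section \<open>The layered graph\<close>

text \<open>
  The vertices are identified by \<open>h\<close> with pairs of a level and a colour. All levels but the last
  contain every colour, and the last one is a best set for the remaining \<open>n mod (t + 1)\<close> vertices
  (it may be empty). Vertices are adjacent if they share a level and their colours differ by at least 2.
  The colour itself is a lambda colouring: equal colours are in different components, and vertices of
  consecutive colours are not adjacent. No lambda colouring has a smaller span: in the first level any
  two vertices are adjacent or have a common neighbour, so their colours are distinct.
\<close>

lemma ex_layered_graph:
  fixes V :: "'a set"
  assumes t: "5 \<le> t" and V: "finite V" "card V = n" and n: "t + 1 \<le> n"
  obtains H :: "'a pair_pre_digraph"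
  where "simple_graph H" "pverts H = V" "lambda_chromatic_number H = t"
    "layered_max t n \<le> card (edges H)"
proof -
  define q where "q = n div (t + 1)"
  have q: "1 \<le> q" using n by (simp add: q_def Suc_le_eq div_greater_zero_iff del: add_Suc_right)
  obtain S where S: "S \<subseteq> {..t}" "card S = n mod (t + 1)"
      "card (separated_pairs S) = max_separated t (n mod (t + 1))"
  proof (rule ex_max_separated)
    show "1 \<le> t" using t by simp
    show "n mod (t + 1) \<le> t + 1" by (intro less_imp_le mod_less_divisor) simp
  qed
  have full: "card (separated_pairs {..t}) = max_separated t (t + 1)"
  proof -
    obtain F where F: "F \<subseteq> {..t}" "card F = t + 1" "card (separated_pairs F) = max_separated t (t + 1)"
      using t by (elim ex_max_separated[of t "t + 1", rotated 2]) auto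
    then have "F = {..t}" by (intro card_subset_eq) auto
    with F show ?thesis by simp
  qed
  define L where "L k = (if k < q then {..t} else S)" for k
  have sub: "L k \<subseteq> {..t}" for k using S(1) by (simp add: L_def)
  have fin: "finite (L k)" for k using sub finite_subset by blast
  let ?D = "Sigma {..q} L"
  have "card ?D = (\<Sum>k\<le>q. card (L k))" using fin by simp
  also have "\<dots> = q * (t + 1) + n mod (t + 1)"
    using S(2) by (simp add: L_def lessThan_Suc_atMost[symmetric])
  also have "\<dots> = n" unfolding q_def by (rule div_mult_mod_eq)
  finally have "card ?D = card V" using V by simp
  then obtain h where h: "bij_betw h V ?D"
    using finite_same_card_bij[of V ?D] V fin by auto
  define lev col where "lev x = fst (h x)" and "col x = snd (h x)" for x
  have inj: "x = y" if "x \<in> V" "y \<in> V" "lev x = lev y" "col x = col y" for x y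
    using h that by (auto simp: bij_betw_def inj_on_def lev_def col_def prod_eq_iff)
  have ex: "\<exists>x\<in>V. lev x = k \<and> col x = i" if "k \<le> q" "i \<in> L k" for k i
  proof -
    have "(k, i) \<in> h ` V" using h that by (auto simp: bij_betw_def)
    then show ?thesis by (metis imageE lev_def col_def fst_conv snd_conv)
  qed
  have col: "col x \<le> t" if "x \<in> V" for x
  proof -
    have "h x \<in> Sigma {..q} L" using h that by (rule bij_betwE[rule_format])
    then have "col x \<in> L (lev x)" by (auto simp: lev_def col_def)
    then show ?thesis using sub by blast
  qed
  define H :: "'a pair_pre_digraph" where "H = \<lparr>pverts = V,
    parcs = {(x, y) \<in> V \<times> V. lev x = lev y \<and> (col x + 2 \<le> col y \<or> col y + 2 \<le> col x)}\<rparr>"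
  have verts: "pverts H = V" by (simp add: H_def)
  have arcs: "(x, y) \<in> parcs H \<longleftrightarrow> x \<in> V \<and> y \<in> V \<and> lev x = lev y \<and>
      (col x + 2 \<le> col y \<or> col y + 2 \<le> col x)" for x y
    by (simp add: H_def)
  have fin_arcs: "finite (parcs H)"
    by (rule finite_subset[of _ "V \<times> V"]) (use V in \<open>auto simp: H_def\<close>)
  have "pair_graph H"
  proof
    show "symmetric (with_proj H)"
      by (auto simp: symmetric_def sym_def arcs)
  qed (use fin_arcs V verts arcs in \<open>auto\<close>)
  moreover have "V \<noteq> {}" using V n by auto
  ultimately have simple: "simple_graph H" by (simp add: simple_graph_def verts)
  interpret pair_graph H by fact

  obtain x0 where x0: "\<And>i. i \<le> t \<Longrightarrow> x0 i \<in> V \<and> lev (x0 i) = 0 \<and> col (x0 i) = i"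
    using ex[of 0] q by (simp add: L_def) metis
  have colouring: "lambda_colouring H col"
    unfolding lambda_colouring_def verts
  proof (intro conjI ballI impI)
    fix u v assume uv: "u \<in> V" "v \<in> V" "u \<noteq> v"
    let ?d = "\<bar>real (col u) - real (col v)\<bar>"
    have "col u = col v \<or> ?d = 1 \<or> ?d \<ge> 2"
    proof -
      have "col u = col v \<or> col u = Suc (col v) \<or> col v = Suc (col u)
          \<or> col v + 2 \<le> col u \<or> col u + 2 \<le> col v" by linarith
      then show ?thesis by (elim disjE) auto
    qed
    then consider "lev u \<noteq> lev v" | "lev u = lev v" "?d = 1" | "?d \<ge> 2"
      using inj[OF uv(1,2)] uv(3) by blast
    then show "3 \<le> ereal ?d + graph_dist H u v"
    proof cases
      case 1
      then have "graph_dist H u v = \<infinity>"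
        by (intro graph_dist_eq_infinity[of lev]) (auto simp: arcs)
      then show ?thesis by simp
    next
      case 2
      then have "(u, v) \<notin> parcs H" by (auto simp: arcs)
      then have "2 \<le> graph_dist H u v" using graph_dist_nonadjacent_ge uv(3) by blast
      then have "ereal 1 + 2 \<le> ereal ?d + graph_dist H u v"
        unfolding 2 by (intro add_mono) auto
      then show ?thesis by simp
    next
      case 3
      then have "ereal 2 + 1 \<le> ereal ?d + graph_dist H u v"
        using graph_dist_distinct_ge[OF uv(3)] by (intro add_mono) simp_all
      then show ?thesis by (simp add: one_ereal_def)
    qed
  next
    show "Min (col ` V) = 0"
      using x0[of 0] V by (intro Min_eqI) (auto intro: rev_image_eqI)
  qed
  have max_col: "max_colour H col = t"
    unfolding max_colour_def verts using x0[of t] V col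
    by (intro Max_eqI) (auto intro: rev_image_eqI)
  have lower: "t \<le> max_colour H c" if c: "lambda_colouring H c" for c
  proof -
    have "inj_on (\<lambda>i. c (x0 i)) {..t}"
    proof (rule inj_onI, rule ccontr)
      fix i j assume ij: "i \<in> {..t}" "j \<in> {..t}" "c (x0 i) = c (x0 j)" "i \<noteq> j"
      have "\<exists>l\<le>t. (i + 2 \<le> l \<or> l + 2 \<le> i) \<and> (j + 2 \<le> l \<or> l + 2 \<le> j)
          \<or> (i + 2 \<le> j \<or> j + 2 \<le> i)"
      proof -
        consider "i + 2 \<le> j \<or> j + 2 \<le> i" | "j = Suc i" | "i = Suc j" using ij by linarith
        \<comment> \<open>For consecutive colours, \<open>0\<close> is a common neighbour if the smaller one is at least 2;
          otherwise both are at most 2, and \<open>5\<close> is a common neighbour.\<close>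
        then show ?thesis
        proof cases
          case 1
          then show ?thesis by blast
        next
          case 2
          then show ?thesis using t ij(1,2) by (cases "2 \<le> i") (auto intro: exI[of _ 0] exI[of _ 5])
        next
          case 3
          then show ?thesis using t ij(1,2) by (cases "2 \<le> j") (auto intro: exI[of _ 0] exI[of _ 5])
        qed
      qed
      then consider "i + 2 \<le> j \<or> j + 2 \<le> i"
        | l where "l \<le> t" "i + 2 \<le> l \<or> l + 2 \<le> i" "j + 2 \<le> l \<or> l + 2 \<le> j"
        by blast
      then have "graph_dist H (x0 i) (x0 j) \<le> 2"
      proof cases
        case 1
        then have "graph_dist H (x0 i) (x0 j) \<le> 1"
          using x0[of i] x0[of j] ij by (intro graph_dist_arc_le) (simp add: arcs)
        then show ?thesis by (rule order_trans) simp
      next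
        case 2
        then show ?thesis
          using x0[of i] x0[of j] x0[of l] ij
          by (intro graph_dist_two_arcs_le[of _ "x0 l"]) (auto simp: arcs)
      qed
      moreover have "x0 i \<noteq> x0 j" using x0[of i] x0[of j] ij by auto
      ultimately show False
        using lambda_colouring_neq[OF c, of "x0 i" "x0 j"] x0[of i] x0[of j] ij verts by simp
    qed
    moreover have "(\<lambda>i. c (x0 i)) ` {..t} \<subseteq> {..max_colour H c}"
      using x0 V by (auto simp: max_colour_def verts)
    ultimately have "card {..t} \<le> card {..max_colour H c}"
      by (intro card_inj_on_le) auto
    then show ?thesis by simp
  qed
  have chrom: "lambda_chromatic_number H = t"
    unfolding lambda_chromatic_number_def
    using colouring max_col lower by (intro Least_equality) auto

  have "layered_max t n = (\<Sum>k\<le>q. card (separated_pairs (L k)))"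
    using S(3) full by (simp add: layered_max_def q_def L_def lessThan_Suc_atMost[symmetric] del: max_separated_Suc)
  also have "\<dots> = card (Sigma {..q} (\<lambda>k. separated_pairs (L k)))"
    using fin by simp
  also have "\<dots> \<le> card (edges H)"
  proof -
    obtain x where x: "\<And>k i. k \<le> q \<Longrightarrow> i \<in> L k \<Longrightarrow> x k i \<in> V \<and> lev (x k i) = k \<and> col (x k i) = i"
      using ex by metis
    let ?g = "\<lambda>(k, i, j). {x k i, x k j}"
    have "inj_on ?g (Sigma {..q} (\<lambda>k. separated_pairs (L k)))"
    proof (rule inj_onI)
      fix p p'
      assume pp: "p \<in> Sigma {..q} (\<lambda>k. separated_pairs (L k))"
        "p' \<in> Sigma {..q} (\<lambda>k. separated_pairs (L k))" "?g p = ?g p'"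
      obtain k i j where p: "p = (k, i, j)" by (metis prod.exhaust)
      obtain k' i' j' where p': "p' = (k', i', j')" by (metis prod.exhaust)
      have *: "k \<le> q" "(i, j) \<in> separated_pairs (L k)" "k' \<le> q" "(i', j') \<in> separated_pairs (L k')"
        and eq: "{x k i, x k j} = {x k' i', x k' j'}"
        using pp by (auto simp: p p')
      have m: "i \<in> L k" "j \<in> L k" "i < j" "i' \<in> L k'" "j' \<in> L k'" "i' < j'"
        using * by (auto simp: separated_pairs_def)
      have vals: "lev (x k i) = k" "col (x k i) = i" "col (x k j) = j"
        "lev (x k' i') = k'" "lev (x k' j') = k'" "col (x k' i') = i'" "col (x k' j') = j'"
        using x * m by blast+
      from eq show "p = p'"
        unfolding p p' doubleton_eq_iff
      proof
        assume "x k i = x k' i' \<and> x k j = x k' j'"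
        then show "(k, i, j) = (k', i', j')" using vals by simp
      next
        assume "x k i = x k' j' \<and> x k j = x k' i'"
        then have "i = j'" "j = i'" using vals by metis+
        then show "(k, i, j) = (k', i', j')" using m(3,6) by simp
      qed
    qed
    moreover have "?g ` Sigma {..q} (\<lambda>k. separated_pairs (L k)) \<subseteq> edges H"
    proof (rule image_subsetI)
      fix p assume p_in: "p \<in> Sigma {..q} (\<lambda>k. separated_pairs (L k))"
      obtain k i j where p: "p = (k, i, j)" by (metis prod.exhaust)
      have "(x k i, x k j) \<in> parcs H"
        using p_in x[of k i] x[of k j] by (simp add: p arcs separated_pairs_def)
      then show "?g p \<in> edges H" by (auto simp: edges_def p)
    qed
    moreover have "finite (edges H)"
      by (rule finite_subset[of _ "Pow V"]) (use V in \<open>auto simp: edges_def arcs\<close>)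
    ultimately show ?thesis by (rule card_inj_on_le)
  qed
  finally show ?thesis by (rule that[OF simple verts chrom])
qed

theorem corollary4p10:
  fixes G :: "'a pair_pre_digraph" and n t :: nat
  assumes "simple_graph G"
    and "card (pverts G) = n"
    and "lambda_chromatic_number G = t"
    and "t \<ge> 5"
    and "n \<ge> t + 1"
    and "contains_max_edges G"
  shows "\<exists>c. optimal_colouring G c \<and> equitable_partition G c"
proof -
  interpret pair_graph G using assms(1) by (simp add: simple_graph_def)
  obtain c where opt: "optimal_colouring G c"
    using ex_optimal_colouring[OF assms(1)] by blast
  then have c: "lambda_colouring G c" and max: "max_colour G c = t"
    using assms(3) by (auto simp: optimal_colouring_def)
  have le: "c u \<le> t" if "u \<in> pverts G" for u
    using that pair_finite_verts max by (auto simp: max_colour_def)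
  let ?s = "\<lambda>i. card (colour_class G c i)"
  have "(\<Sum>i\<le>t. ?s i) = card (\<Union>i\<le>t. colour_class G c i)"
    using pair_finite_verts by (intro card_UN_disjoint[symmetric]) (auto simp: colour_class_def)
  also have "(\<Union>i\<le>t. colour_class G c i) = pverts G"
    using le by (auto simp: colour_class_def)
  finally have sum: "(\<Sum>i\<le>t. ?s i) = n" using assms(2) by simp
  obtain H :: "'a pair_pre_digraph" where H: "simple_graph H" "pverts H = pverts G"
      "lambda_chromatic_number H = t" "layered_max t n \<le> card (edges H)"
    using ex_layered_graph[OF assms(4) pair_finite_verts assms(2) assms(5)] by blast
  have "layered_max t n \<le> card (edges G)"
    using H assms(3,6) unfolding contains_max_edges_def by fastforce
  also have "\<dots> \<le> (\<Sum>(i, j)\<in>separated_pairs {..t}. min (?s i) (?s j))"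
    using card_edges_le[OF assms(1) c le] by simp
  finally have near: "?s i \<le> ?s j + 1" if "i \<le> t" "j \<le> t" for i j
    using nearly_equal_if_extremal[OF assms(4), of ?s i j] that sum by simp
  have "\<bar>int (?s i) - int (?s j)\<bar> \<le> 1" if "i \<le> t" "j \<le> t" for i j
    using near[of i j] near[of j i] that by (simp add: abs_le_iff)
  then have "equitable_partition G c"
    unfolding equitable_partition_def max by blast
  with opt show ?thesis by blast
qed

end
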